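(* Let $G$ be a finite simple apex graph with $n \ge 7$ vertices and exactly $t$ triangles. Then $G$ has at most $3n-9+\frac{t}{3}$ edges, i.e. $|E(G)| \le 3n-9+\frac{t}{3}$.
   Context: All graphs are finite and simple. A graph $G$ is apex if it can be made planar by deleting one vertex, i.e. there is a vertex $v$ of $G$ such that $G-v$ is planar (in particular, planar graphs with at least one vertex are apex). A triangle of $G$ is a (not necessarily induced or facial) subgraph of $G$ isomorphic to $K_3$, i.e. a set of three pairwise adjacent vertices; $t$ is the total number of such triangles in $G$. *)

theory Defs
  imports "HOL-Analysis.Analysis"
begin

text \<open>A finite simple graph is given by a vertex set \<open>V\<close> and a set \<open>E\<close> of two-element subsets
  of \<open>V\<close>.\<close>

definition simple_graph :: "'a set \<Rightarrow> 'a set set \<Rightarrow> bool" where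
  "simple_graph V E \<longleftrightarrow> finite V \<and> (\<forall>e\<in>E. e \<subseteq> V \<and> card e = 2)"

text \<open>Planarity is topological: there is a drawing in the plane (identified with \<^typ>\<open>complex\<close>) in
  which vertices are distinct points, every edge is a simple arc joining its two end vertices and
  meeting no other vertex, and two different edges meet at most in common end vertices. Arcs are
  arbitrary continuous injective paths, not necessarily polygonal.\<close>

definition plane_drawing ::
    "'a set \<Rightarrow> 'a set set \<Rightarrow> ('a \<Rightarrow> complex) \<Rightarrow> ('a set \<Rightarrow> real \<Rightarrow> complex) \<Rightarrow> bool" where
  "plane_drawing V E p c \<longleftrightarrow>
     inj_on p V \<and>
     (\<forall>e\<in>E. arc (c e) \<and>
            {pathstart (c e), pathfinish (c e)} = p ` e \<and>
            path_image (c e) \<inter> p ` V = p ` e) \<and>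
     (\<forall>e\<in>E. \<forall>f\<in>E. e \<noteq> f \<longrightarrow> path_image (c e) \<inter> path_image (c f) \<subseteq> p ` (e \<inter> f))"

definition planar :: "'a set \<Rightarrow> 'a set set \<Rightarrow> bool" where
  "planar V E \<longleftrightarrow> (\<exists>p c. plane_drawing V E p c)"

definition apex :: "'a set \<Rightarrow> 'a set set \<Rightarrow> bool" where
  "apex V E \<longleftrightarrow> (\<exists>v\<in>V. planar (V - {v}) {e \<in> E. v \<notin> e})"

definition triangles :: "'a set \<Rightarrow> 'a set set \<Rightarrow> 'a set set" where
  "triangles V E = {T. T \<subseteq> V \<and> card T = 3 \<and> (\<forall>x\<in>T. \<forall>y\<in>T. x \<noteq> y \<longrightarrow> {x, y} \<in> E)}"

end

theory Submission
  imports Defs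
begin

text \<open>
  Deleting an edge that lies in at least three triangles lowers the right-hand side by at least as
  much as the left-hand side, so every edge of \<open>G\<close> may be assumed to lie in at most two. Let \<open>H = G - v\<close> be planar with \<open>m\<close> vertices and
  \<open>t(H)\<close> triangles, let \<open>S\<close> be the neighbourhood of \<open>v\<close> and \<open>T\<close> the set of the other \<open>k\<close> vertices of \<open>H\<close>.
  Counting faces by length gives \<open>2 e(H) \<le> 4 m - 8 + t(H)\<close>, and with this bound the claim reduces to
  \<open>t(H) + 12 \<le> 6 k + 2 e(S)\<close>. Every triangle of \<open>H\<close> has an edge inside \<open>S\<close> (each lying in at most one
  triangle of \<open>H\<close>) or inside \<open>T\<close> (each lying in at most two), so \<open>t(H) \<le> e(S) + 2 e(T)\<close>, and
  \<open>e(T) \<le> 3 k - 6\<close> when \<open>k \<ge> 3\<close>; the cases \<open>k \<le> 2\<close> are handled by hand.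

  The face count for arbitrary, possibly wild, arcs rests on the Jordan curve theorem and on
  Janiszewski's theorem: a new arc splits one face into two if its ends were already joined in the
  graph, and splits no face otherwise.
\<close>

section \<open>Arcs in the plane\<close>

text \<open>Components other than \<open>C0\<close> are disjoint from \<open>C0\<close>, hence from
  \<open>K\<close>, and stay maximal in the smaller set. So deleting \<open>K\<close> cuts up
  \<open>C0\<close> alone, which later localises a new arc to a single face.\<close>

lemma components_Diff:
  assumes C0: "C0 \<in> components U" and K: "K \<inter> U \<subseteq> C0"
  shows "components (U - K) = (components U - {C0}) \<union> components (C0 - K)"
proof -
  have 1: "C \<in> components (U - K)" if "C \<in> components U" "C \<noteq> C0" for C
  proof -
    have "C \<inter> C0 = {}" using components_nonoverlap[OF that(1) C0] that(2) by auto
    then have "C \<subseteq> U - K" using K in_components_subset[OF that(1)] by blast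
    then show ?thesis using components_intermediate_subset[OF that(1)] by blast
  qed
  have 2: "C \<in> components (U - K)" if C: "C \<in> components (C0 - K)" for C
    unfolding in_components_maximal
  proof (intro conjI allI impI)
    show "C \<noteq> {}" "connected C"
      using C in_components_nonempty in_components_connected by auto
    show "C \<subseteq> U - K" using in_components_subset[OF C] in_components_subset[OF C0] by blast
    fix D assume D: "D \<noteq> {} \<and> C \<subseteq> D \<and> D \<subseteq> U - K \<and> connected D"
    have "C0 \<inter> D \<noteq> {}"
      using D in_components_nonempty[OF C] in_components_subset[OF C] by blast
    then have "D \<subseteq> C0" using components_maximal[OF C0, of D] D by blast
    then have "D \<subseteq> C0 - K" using D by blast
    then show "D = C" using C D unfolding in_components_maximal by blast
  qed
  have 3: "C \<in> (components U - {C0}) \<union> components (C0 - K)" if C: "C \<in> components (U - K)" for C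
  proof -
    obtain x where x: "x \<in> C" using in_components_nonempty[OF C] by blast
    have sub: "C \<subseteq> U - K" by (rule in_components_subset[OF C])
    obtain C' where C': "C' \<in> components U" "C \<subseteq> C'"
      using exists_component_superset[of C U] sub x in_components_connected[OF C] by blast
    show ?thesis
    proof (cases "C' = C0")
      case True
      have "C \<subseteq> C0 - K" using C' True sub by blast
      then show ?thesis using components_intermediate_subset[OF C]
        in_components_subset[OF C0] by blast
    next
      case False
      have "C = C'" using components_eq[OF C 1[OF C'(1) False]] x C'(2) by blast
      then show ?thesis using C' False by blast
    qed
  qed
  show ?thesis using 1 2 3 by blast
qed

text \<open>Three components would supply three points, no two of them connected. The criterion
  speaks of points because Janiszewski's theorem yields connectedness of pairs of points.\<close>

lemma card_components_le_2:
  assumes "\<And>a b c. \<lbrakk>a \<in> S; b \<in> S; c \<in> S\<rbrakk> \<Longrightarrow>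
    connected_component S a b \<or> connected_component S a c \<or> connected_component S b c"
  shows "finite (components S) \<and> card (components S) \<le> 2"
proof (rule ccontr)
  assume "\<not> ?thesis"
  then have "infinite (components S) \<or> 3 \<le> card (components S)" by linarith
  then have "\<exists>F. F \<subseteq> components S \<and> finite F \<and> card F = 3"
    using infinite_arbitrarily_large[of "components S" 3] obtain_subset_with_card_n[of 3 "components S"] by metis
  then obtain A B C where ABC: "{A, B, C} \<subseteq> components S" and ne: "A \<noteq> B" "A \<noteq> C" "B \<noteq> C"
    unfolding card_3_iff by blast
  then have "A \<in> components S" "B \<in> components S" "C \<in> components S" by auto
  then obtain a b c where "a \<in> S" "b \<in> S" "c \<in> S" and ABC: "A = connected_component_set S a"
    "B = connected_component_set S b" "C = connected_component_set S c"
    unfolding components_def by blast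
  with assms[of a b c] ne show False
    using connected_component_eq[of b S a] connected_component_eq[of c S a] connected_component_eq[of c S b]
    by auto
qed

text \<open>Pigeonhole: the inside and the outside of a Jordan curve are connected and cover its
  complement, so two of the three points share a side.\<close>

lemma Jordan_two_components:
  fixes C :: "real \<Rightarrow> complex"
  assumes "simple_path C" "pathfinish C = pathstart C" "a \<notin> path_image C" "b \<notin> path_image C" "d \<notin> path_image C"
  shows "connected_component (- path_image C) a b \<or> connected_component (- path_image C) a d \<or>
    connected_component (- path_image C) b d"
proof -
  note J = Jordan_inside_outside[OF assms(1,2)]
  have "connected_component (- path_image C) x y" if "x \<in> D" "y \<in> D"
    "D = inside (path_image C) \<or> D = outside (path_image C)" for x y D
  proof -
    have "connected D" "D \<subseteq> - path_image C"
      using J that(3) inside_no_overlap[of "path_image C"] outside_no_overlap[of "path_image C"] by blast+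
    then show ?thesis using that by (auto simp: connected_component_def)
  qed
  moreover have "a \<in> inside (path_image C) \<union> outside (path_image C)"
    "b \<in> inside (path_image C) \<union> outside (path_image C)"
    "d \<in> inside (path_image C) \<union> outside (path_image C)"
    using J assms by auto
  ultimately show ?thesis by blast
qed

section \<open>Arcs that cross a component of the complement of a set\<close>

lemma arc_crosscut_le_2:
  fixes g s :: "real \<Rightarrow> complex"
  assumes X: "compact X" and g: "arc g" and s: "arc s" "path_image s \<subseteq> X"
    and ends: "pathstart s = pathfinish g" "pathfinish s = pathstart g"
    and gX: "path_image g \<inter> X \<subseteq> {pathstart g, pathfinish g}"
    and con: "connected_component (- X) a b" "connected_component (- X) a d"
    and nin: "a \<notin> path_image g" "b \<notin> path_image g" "d \<notin> path_image g"
  shows "connected_component (- (X \<union> path_image g)) a b \<or>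
    connected_component (- (X \<union> path_image g)) a d \<or> connected_component (- (X \<union> path_image g)) b d"
proof -
  define C where "C = g +++ s"
  have C: "simple_path C" unfolding C_def
    by (rule simple_path_join_loop) (use g s ends gX in auto)
  have im: "path_image C = path_image g \<union> path_image s"
    unfolding C_def using ends by (simp add: path_image_join)
  have loop: "pathfinish C = pathstart C" unfolding C_def using ends by simp
  have int: "path_image C \<inter> X = path_image s"
    using im s(2) gX ends pathfinish_in_path_image[of s] pathstart_in_path_image[of s] by auto
  \<comment> \<open>Two of the three points lie on the same side of the Jordan curve \<open>C\<close>, and \<open>C\<close> meets \<open>X\<close> in the
    connected set \<open>path_image s\<close>, so Janiszewski's theorem applies.\<close>
  have J: "connected_component (- (X \<union> path_image g)) x y" 
    if "connected_component (- path_image C) x y" "connected_component (- X) x y" for x y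
  proof -
    have "connected_component (- (path_image C \<union> X)) x y"
      by (rule Janiszewski) (use C X that s int in \<open>auto simp: compact_simple_path_image compact_imp_closed connected_arc_image\<close>)
    moreover have "path_image C \<union> X = X \<union> path_image g" using im s(2) by blast
    ultimately show ?thesis by simp
  qed
  have con': "connected_component (- X) b d"
    using con by (meson connected_component_sym connected_component_trans)
  have "a \<notin> X" "b \<notin> X" "d \<notin> X" using con connected_component_in by fastforce+
  then have "a \<notin> path_image C" "b \<notin> path_image C" "d \<notin> path_image C"
    using nin im s(2) by auto
  from Jordan_two_components[OF C loop this] J con con' show ?thesis by blast
qed

text \<open>The arc \<open>s\<close> closes \<open>g\<close> up to a Jordan curve. An inner point of
  \<open>g\<close> is in the frontier of both sides of this curve, so its open neighbourhood
  \<open>U\<close> meets both sides. As \<open>U\<close> avoids \<open>X\<close>, the two sides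
  cover \<open>U - path_image g\<close> and disconnect it.\<close>

lemma arc_crosscut_disconnects:
  fixes g s :: "real \<Rightarrow> complex"
  assumes g: "arc g" and s: "arc s" "path_image s \<subseteq> X"
    and ends: "pathstart s = pathfinish g" "pathfinish s = pathstart g"
    and gX: "path_image g \<inter> X \<subseteq> {pathstart g, pathfinish g}"
    and U: "open U" "U \<inter> X = {}" "path_image g - {pathstart g, pathfinish g} \<subseteq> U"
  shows "\<not> connected (U - path_image g)"
proof
  assume con: "connected (U - path_image g)"
  define C where "C = g +++ s"
  have C: "simple_path C" unfolding C_def
    by (rule simple_path_join_loop) (use g s ends gX in auto)
  have im: "path_image C = path_image g \<union> path_image s"
    unfolding C_def using ends by (simp add: path_image_join)
  have loop: "pathfinish C = pathstart C" unfolding C_def using ends by simp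
  note J = Jordan_inside_outside[OF C loop]
  obtain y where y: "y \<in> path_image g - {pathstart g, pathfinish g}"
    using nonempty_simple_path_endless[OF arc_imp_simple_path[OF g]] by blast
  then have "y \<in> U" "y \<in> frontier (inside (path_image C))" "y \<in> frontier (outside (path_image C))"
    using U J im by auto
  then have "y \<in> closure (inside (path_image C))" "y \<in> closure (outside (path_image C))"
    by (auto simp: frontier_def)
  then obtain a b where ab: "a \<in> U" "a \<in> inside (path_image C)" "b \<in> U" "b \<in> outside (path_image C)"
    using U(1) \<open>y \<in> U\<close> by (metis IntI disjoint_iff open_Int_closure_eq_empty)
  have UC: "U - path_image g \<subseteq> inside (path_image C) \<union> outside (path_image C)"
    using J im s(2) U(2) by auto
  have "inside (path_image C) \<inter> (U - path_image g) \<noteq> {}"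
    "outside (path_image C) \<inter> (U - path_image g) \<noteq> {}"
    using ab im inside_no_overlap[of "path_image C"] outside_no_overlap[of "path_image C"] by blast+
  moreover have "inside (path_image C) \<inter> outside (path_image C) \<inter> (U - path_image g) = {}"
    "open (inside (path_image C))" "open (outside (path_image C))" using J by auto
  ultimately show False
    using connectedD[OF con, of "inside (path_image C)" "outside (path_image C)"] UC by blast
qed

text \<open>A connected set with more than one point is perfect, and its limit points survive the
  deletion of the two ends.\<close>

lemma closure_arc_endless:
  fixes g :: "real \<Rightarrow> 'a :: euclidean_space"
  assumes "arc g"
  shows "path_image g \<subseteq> closure (path_image g - {pathstart g, pathfinish g})"
proof
  fix y assume y: "y \<in> path_image g"
  have "y islimpt path_image g"
  proof (rule connected_imp_perfect)
    show "connected (path_image g)" using assms by (simp add: connected_arc_image)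
    show "path_image g \<noteq> {x}" for x
      using arc_distinct_ends[OF assms] pathstart_in_path_image[of g] pathfinish_in_path_image[of g] by auto
  qed (fact y)
  then have "y islimpt {pathstart g, pathfinish g} \<union> (path_image g - {pathstart g, pathfinish g})"
    by (rule islimpt_subset) blast
  then have "y islimpt path_image g - {pathstart g, pathfinish g}"
    by (subst (asm) islimpt_Un_finite) auto
  then show "y \<in> closure (path_image g - {pathstart g, pathfinish g})"
    by (simp add: closure_def)
qed

text \<open>The inverse of the arc would embed a nonempty open subset of the plane into the line,
  against invariance of dimension.\<close>

lemma open_not_subset_arc:
  fixes g :: "real \<Rightarrow> complex"
  assumes "arc g" "open U" "U \<noteq> {}"
  shows "\<not> U \<subseteq> path_image g"
proof
  assume U: "U \<subseteq> path_image g"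
  obtain h where h: "homeomorphism {0..1} (path_image g) g h"
    using homeomorphism_arc[OF assms(1)] .
  have "continuous_on U h" "inj_on h U"
    using h U by (auto simp: homeomorphism_def inj_on_def intro: continuous_on_subset) (metis subsetD)
  then have "DIM(complex) \<le> DIM(real)"
    using assms invariance_of_dimension by blast
  then show False by simp
qed

text \<open>An arc does not separate the plane, so Janiszewski's theorem applies as soon as the arc
  meets \<open>X\<close> in a connected set.\<close>

lemma connected_minus_arc:
  fixes g :: "real \<Rightarrow> complex"
  assumes "compact X" "arc g" "connected (X \<inter> path_image g)" "connected_component (- X) a b"
    "a \<notin> path_image g" "b \<notin> path_image g"
  shows "connected_component (- (X \<union> path_image g)) a b"
proof (rule Janiszewski)
  have "connected (- path_image g)" using connected_arc_complement[OF assms(2)] by simp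
  then show "connected_component (- path_image g) a b"
    using assms by (auto simp: connected_component_def)
qed (use assms closed_arc_image in auto)

lemma connected_subset_sing: "S \<subseteq> {a} \<Longrightarrow> connected S"
  by (metis connected_empty connected_sing subset_singletonD)

section \<open>Faces of plane graphs\<close>

lemma finite_triangles: "finite V \<Longrightarrow> finite (triangles V E)"
  by (rule finite_subset[of _ "Pow V"]) (auto simp: triangles_def)

lemma simple_graph_finite: "simple_graph V E \<Longrightarrow> finite V \<and> finite E"
  by (auto simp: simple_graph_def intro: rev_finite_subset[of "Pow V"])

text \<open>The drawing is fixed once; subgraphs are edge sets \<open>B \<subseteq> E\<close> drawn
  by the same arcs, so that edges can be added one at a time.\<close>

locale plane_graph =
  fixes V :: "'a set" and E :: "'a set set" and p :: "'a \<Rightarrow> complex" and c :: "'a set \<Rightarrow> real \<Rightarrow> complex"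
  assumes simple: "simple_graph V E" and drawing: "plane_drawing V E p c"
begin

text \<open>Only arcs count: isolated vertices are not removed from the plane, and the empty edge
  set has the whole plane as its only face.\<close>

definition skeleton :: "'a set set \<Rightarrow> complex set" where
  "skeleton B = (\<Union>e\<in>B. path_image (c e))"

definition faces :: "'a set set \<Rightarrow> complex set set" where
  "faces B = components (- skeleton B)"

definition reach :: "'a set set \<Rightarrow> ('a \<times> 'a) set" where
  "reach B = {(x, y). {x, y} \<in> B}\<^sup>*"

lemma finite_V: "finite V" and edge_subset: "e \<in> E \<Longrightarrow> e \<subseteq> V" and card_edge: "e \<in> E \<Longrightarrow> card e = 2"
  using simple by (auto simp: simple_graph_def)

lemma finite_E: "finite E"
  using simple_graph_finite[OF simple] by blast

lemma inj_p: "inj_on p V" and arc_edge: "e \<in> E \<Longrightarrow> arc (c e)"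
  and ends_edge: "e \<in> E \<Longrightarrow> {pathstart (c e), pathfinish (c e)} = p ` e"
  and edge_Int: "\<lbrakk>e \<in> E; f \<in> E; e \<noteq> f\<rbrakk> \<Longrightarrow> path_image (c e) \<inter> path_image (c f) \<subseteq> p ` (e \<inter> f)"
  using drawing unfolding plane_drawing_def by blast+

lemma ends_in_edge: "e \<in> E \<Longrightarrow> p ` e \<subseteq> path_image (c e)"
  using ends_edge[of e] pathstart_in_path_image[of "c e"] pathfinish_in_path_image[of "c e"]
  by (metis empty_subsetI insert_subset)

lemma edge_cases:
  assumes "e \<in> E"
  obtains x y where "e = {x, y}" "x \<noteq> y" "x \<in> V" "y \<in> V" "pathstart (c e) = p x" "pathfinish (c e) = p y"
proof -
  obtain a b where ab: "e = {a, b}" "a \<noteq> b" using card_edge[OF assms] by (auto simp: card_2_iff)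
  then have "a \<in> V" "b \<in> V" using edge_subset[OF assms] by auto
  moreover have "{pathstart (c e), pathfinish (c e)} = {p a, p b}" using ends_edge[OF assms] ab by simp
  ultimately show thesis using that[of a b] that[of b a] ab by (auto simp: doubleton_eq_iff)
qed

lemma compact_skeleton: "B \<subseteq> E \<Longrightarrow> compact (skeleton B)"
  unfolding skeleton_def using finite_E arc_edge
  by (intro compact_UN) (auto intro: finite_subset compact_arc_image)

lemma open_Compl_skeleton: "B \<subseteq> E \<Longrightarrow> open (- skeleton B)"
  using compact_skeleton compact_imp_closed by blast

lemma open_face: "B \<subseteq> E \<Longrightarrow> f \<in> faces B \<Longrightarrow> open f"
  unfolding faces_def using open_Compl_skeleton open_components by blast

lemma skeleton_mono: "A \<subseteq> B \<Longrightarrow> skeleton A \<subseteq> skeleton B"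
  by (auto simp: skeleton_def)

lemma skeleton_insert: "skeleton (insert e B) = skeleton B \<union> path_image (c e)"
  by (auto simp: skeleton_def)

lemma skeleton_Int_edge:
  assumes "B \<subseteq> E" "e \<in> E" "e \<notin> B"
  shows "skeleton B \<inter> path_image (c e) \<subseteq> p ` (e \<inter> \<Union>B)"
proof
  fix z assume "z \<in> skeleton B \<inter> path_image (c e)"
  then obtain f where f: "f \<in> B" "z \<in> path_image (c f)" "z \<in> path_image (c e)"
    by (auto simp: skeleton_def)
  then have "z \<in> p ` (f \<inter> e)" using edge_Int[of f e] assms by blast
  then show "z \<in> p ` (e \<inter> \<Union>B)" using f by blast
qed

lemma skeleton_Int:
  assumes "A \<subseteq> E" "B \<subseteq> E" "A \<inter> B = {}"
  shows "skeleton A \<inter> skeleton B \<subseteq> p ` (\<Union>A \<inter> \<Union>B)"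
proof
  fix z assume "z \<in> skeleton A \<inter> skeleton B"
  then obtain e where e: "e \<in> B" "z \<in> path_image (c e)" "z \<in> skeleton A"
    by (auto simp: skeleton_def)
  moreover have "e \<in> E" "e \<notin> A" using e assms by auto
  ultimately have "z \<in> p ` (e \<inter> \<Union>A)" using skeleton_Int_edge[OF assms(1), of e] by blast
  then show "z \<in> p ` (\<Union>A \<inter> \<Union>B)" using e by blast
qed

section \<open>Reachability in the graph and in the plane\<close>

lemma reach_sym: "(x, y) \<in> reach B \<Longrightarrow> (y, x) \<in> reach B"
  unfolding reach_def by (rule symD[OF sym_rtrancl]) (auto simp: sym_def insert_commute)

lemma reach_refl [simp]: "(x, x) \<in> reach B"
  and reach_trans: "(x, y) \<in> reach B \<Longrightarrow> (y, z) \<in> reach B \<Longrightarrow> (x, z) \<in> reach B"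
  and reach_edge: "{x, y} \<in> B \<Longrightarrow> (x, y) \<in> reach B"
  by (auto simp: reach_def)

lemma reach_mono: "A \<subseteq> B \<Longrightarrow> reach A \<subseteq> reach B"
  unfolding reach_def by (rule rtrancl_mono) auto

lemma reach_in_Union: "(x, y) \<in> reach B \<Longrightarrow> x \<noteq> y \<Longrightarrow> y \<in> \<Union>B"
  unfolding reach_def by (erule rtranclE) auto

text \<open>The arcs along a walk are joined end to end. The condition \<open>x \<noteq> y\<close>
  excludes the trivial walk at an isolated vertex, whose point does not lie on the skeleton.\<close>

lemma reach_path_component:
  assumes B: "B \<subseteq> E" and "(x, y) \<in> reach B" "x \<noteq> y"
  shows "path_component (skeleton B) (p x) (p y)"
proof -
  have "x = y \<or> path_component (skeleton B) (p x) (p y)"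
    using assms(2) unfolding reach_def
  proof (induction rule: rtrancl_induct)
    case (step y z)
    then have yz: "{y, z} \<in> B" by simp
    then have "{y, z} \<in> E" using B by blast
    from ends_in_edge[OF this] have "p y \<in> path_image (c {y,z})" "p z \<in> path_image (c {y,z})" by auto
    moreover have "path_connected (path_image (c {y,z}))"
      using arc_edge[OF \<open>{y,z} \<in> E\<close>] arc_imp_path path_connected_path_image by blast
    moreover have "path_image (c {y,z}) \<subseteq> skeleton B" using yz by (auto simp: skeleton_def)
    ultimately have "path_component (skeleton B) (p y) (p z)"
      by (meson path_component_of_subset path_connected_component)
    then show ?case using step.IH path_component_trans by metis
  qed simp
  then show ?thesis using assms by blast
qed

section \<open>The effect of one new edge on the faces\<close>

lemma connected_component_insert_unreach:
  assumes B: "B \<subseteq> E" and e: "e \<in> E" "e \<notin> B" "e = {x, y}" "(x, y) \<notin> reach B"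
    and ab: "connected_component (- skeleton B) a b" "a \<notin> path_image (c e)" "b \<notin> path_image (c e)"
  shows "connected_component (- skeleton (insert e B)) a b"
proof -
  \<comment> \<open>Two applications of Janiszewski's theorem: the part of the skeleton around \<open>x\<close> and the rest are
    disjoint, and each meets the new arc in at most one point.\<close>
  define B1 where "B1 = {f \<in> B. \<exists>z\<in>f. (x, z) \<in> reach B}"
  define B2 where "B2 = B - B1"
  have B12: "B = B1 \<union> B2" "B1 \<inter> B2 = {}" "B1 \<subseteq> E" "B2 \<subseteq> E" using B by (auto simp: B1_def B2_def)
  \<comment> \<open>If one end of an edge of \<open>B\<close> is reachable from \<open>x\<close>, so
    is the other. Hence \<open>B1\<close> and \<open>B2\<close> share no vertex, and
    \<open>y\<close> lies on no edge of \<open>B1\<close>.\<close>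
  have reach1: "(x, w) \<in> reach B" if "f \<in> B1" "w \<in> f" for f w
  proof -
    from that obtain z where z: "f \<in> B" "z \<in> f" "(x, z) \<in> reach B" by (auto simp: B1_def)
    have "card f = 2" using z B card_edge by blast
    then have "z = w \<or> f = {z, w}" using z that by (auto simp: card_2_iff)
    then have "(z, w) \<in> reach B" using reach_edge z by auto
    then show ?thesis using z reach_trans by blast
  qed
  have disj: "\<Union>B1 \<inter> \<Union>B2 = {}"
    using reach1 by (auto simp: B2_def B1_def)
  have y1: "y \<notin> \<Union>B1" using reach1 e(4) by auto
  have x2: "x \<notin> \<Union>B2" using reach_refl[of x B] unfolding B1_def B2_def by blast
  have "e \<notin> B1" "e \<notin> B2" using e B12 by auto
  have i1: "skeleton B1 \<inter> path_image (c e) \<subseteq> {p x}"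
    using skeleton_Int_edge[OF B12(3) e(1) \<open>e \<notin> B1\<close>] y1 e(3) by auto
  have i2: "skeleton B2 \<inter> path_image (c e) \<subseteq> {p y}"
    using skeleton_Int_edge[OF B12(4) e(1) \<open>e \<notin> B2\<close>] x2 e(3) by auto
  have i3: "skeleton B1 \<inter> skeleton B2 = {}"
    using skeleton_Int[OF B12(3,4,2)] disj by auto
  have ab12: "connected_component (- skeleton B1) a b" "connected_component (- skeleton B2) a b"
    using ab(1) skeleton_mono[of B1 B] skeleton_mono[of B2 B] B12(1)
    by (auto intro: connected_component_of_subset)
  have 1: "connected_component (- (skeleton B1 \<union> path_image (c e))) a b"
    by (rule connected_minus_arc)
      (use i1 ab12 ab compact_skeleton B12 arc_edge e connected_subset_sing in auto)
  have "connected_component (- (skeleton B2 \<union> (skeleton B1 \<union> path_image (c e)))) a b"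
  proof (rule Janiszewski[OF _ _ _ ab12(2) 1])
    show "compact (skeleton B2)" "closed (skeleton B1 \<union> path_image (c e))"
      using compact_skeleton[OF B12(4)] compact_skeleton[OF B12(3)] closed_arc_image[OF arc_edge[OF e(1)]]
      by (auto intro: compact_imp_closed)
    show "connected (skeleton B2 \<inter> (skeleton B1 \<union> path_image (c e)))"
      by (rule connected_subset_sing[of _ "p y"]) (use i2 i3 in auto)
  qed
  moreover have "skeleton (insert e B) = skeleton B2 \<union> (skeleton B1 \<union> path_image (c e))"
    using B12(1) by (auto simp: skeleton_def)
  ultimately show ?thesis by simp
qed

text \<open>The new open arc is connected and misses the skeleton, so it runs inside one face
  \<open>f0\<close> and cuts no other. If its ends were joined before, an arc in the skeleton closes
  it to a Jordan curve and \<open>f0\<close> falls into exactly two pieces; otherwise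
  \<open>f0\<close> stays connected. The pieces themselves are exposed, and not only their number,
  because edge-face incidences are read off from them too.\<close>

lemma split_face:
  assumes B: "B \<subseteq> E" and e: "e \<in> E" "e \<notin> B"
  obtains f0 where "f0 \<in> faces B" "path_image (c e) - p ` e \<subseteq> f0"
    "faces (insert e B) = (faces B - {f0}) \<union> components (f0 - path_image (c e))"
    "(faces B - {f0}) \<inter> components (f0 - path_image (c e)) = {}"
    "finite (components (f0 - path_image (c e)))"
    "1 \<le> card (components (f0 - path_image (c e)))" "card (components (f0 - path_image (c e))) \<le> 2"
    "\<And>x y. e = {x, y} \<Longrightarrow> (x, y) \<in> reach B \<longleftrightarrow> card (components (f0 - path_image (c e))) = 2"
proof -
  let ?g = "path_image (c e)" and ?X = "skeleton B"
  note arc = arc_edge[OF e(1)]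
  obtain x y where xy: "e = {x, y}" "x \<noteq> y" "x \<in> V" "y \<in> V" "pathstart (c e) = p x" "pathfinish (c e) = p y"
    using edge_cases[OF e(1)] .
  have pe: "p ` e = {pathstart (c e), pathfinish (c e)}" using xy by auto
  have gX: "?g \<inter> ?X \<subseteq> {pathstart (c e), pathfinish (c e)}"
    using skeleton_Int_edge[OF B e] pe by auto
  \<comment> \<open>An end of the arc may or may not lie on the skeleton; in either case
    \<open>?g - ?X\<close> lies between the open arc and its closure.\<close>
  have con: "connected (?g - ?X)"
  proof (rule connected_intermediate_closure)
    show "connected (?g - {pathstart (c e), pathfinish (c e)})"
      using connected_simple_path_endless arc arc_imp_simple_path by blast
    show "?g - ?X \<subseteq> closure (?g - {pathstart (c e), pathfinish (c e)})"
      using closure_arc_endless[OF arc] by blast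
  qed (use gX in blast)
  have ne: "?g - p ` e \<noteq> {}" "?g - p ` e \<subseteq> ?g - ?X"
    using nonempty_simple_path_endless arc arc_imp_simple_path pe gX by auto
  obtain f0 where f0: "f0 \<in> faces B" "?g - ?X \<subseteq> f0"
    using exists_component_superset[of "?g - ?X" "- ?X"] con ne unfolding faces_def by blast
  note f0c = f0(1)[unfolded faces_def]
  have f0X: "f0 \<inter> ?X = {}" using in_components_subset[OF f0c] by blast
  have fs: "faces (insert e B) = (faces B - {f0}) \<union> components (f0 - ?g)"
    using components_Diff[OF f0c, of ?g] f0(2) by (auto simp: faces_def skeleton_insert Diff_eq)
  have f0_con: "connected_component (- ?X) a b" if "a \<in> f0" "b \<in> f0" for a b
    using that in_components_connected[OF f0c] in_components_subset[OF f0c]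
    by (auto simp: connected_component_def)
  \<comment> \<open>A connected set that avoids the skeleton and meets the component
    \<open>f0\<close> stays inside \<open>f0\<close>.\<close>
  have lift: "connected_component (f0 - ?g) a b"
    if "a \<in> f0" "connected_component (- (?X \<union> ?g)) a b" for a b
  proof -
    from that(2) obtain T where T: "connected T" "T \<subseteq> - (?X \<union> ?g)" "a \<in> T" "b \<in> T"
      by (auto simp: connected_component_def)
    have "T \<subseteq> f0" using components_maximal[OF f0c T(1)] T that(1) by blast
    then show ?thesis using T unfolding connected_component_def by blast
  qed
  have nonempty: "f0 - ?g \<noteq> {}"
    using open_not_subset_arc[OF arc open_face[OF B f0(1)]] in_components_nonempty[OF f0c] by auto
  have unreach: "connected (f0 - ?g)" if "(x, y) \<notin> reach B"
    unfolding connected_iff_connected_component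
  proof (intro ballI)
    fix a b assume ab: "a \<in> f0 - ?g" "b \<in> f0 - ?g"
    have "connected_component (- skeleton (insert e B)) a b"
      by (rule connected_component_insert_unreach[OF B e xy(1) that f0_con]) (use ab in auto)
    then show "connected_component (f0 - ?g) a b" using lift ab by (simp add: skeleton_insert)
  qed
  have sep: "\<not> connected (f0 - ?g)" and le2: "finite (components (f0 - ?g)) \<and> card (components (f0 - ?g)) \<le> 2"
    if r: "(x, y) \<in> reach B"
  proof -
    \<comment> \<open>The direction is from \<open>p y\<close> back to \<open>p x\<close>, so that
      the arc extracted from this path closes \<open>c e\<close> to a loop.\<close>
    have "path_component ?X (p y) (p x)"
      using reach_path_component[OF B r xy(2)] path_component_sym by blast
    then obtain q where "path q" "path_image q \<subseteq> ?X" "pathstart q = p y" "pathfinish q = p x"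
      by (auto simp: path_component_def)
    moreover have "p y \<noteq> p x" using inj_p xy by (auto simp: inj_on_def)
    ultimately obtain s where s: "arc s" "path_image s \<subseteq> ?X" "pathstart s = p y" "pathfinish s = p x"
      using path_contains_arc[of q "p y" "p x"] by (metis subset_trans)
    show "\<not> connected (f0 - ?g)"
      by (rule arc_crosscut_disconnects[OF arc s(1,2)])
        (use s xy gX open_face[OF B f0(1)] f0X f0(2) ne pe in auto)
    show "finite (components (f0 - ?g)) \<and> card (components (f0 - ?g)) \<le> 2"
    proof (rule card_components_le_2)
      fix a b d assume abd: "a \<in> f0 - ?g" "b \<in> f0 - ?g" "d \<in> f0 - ?g"
      have "connected_component (- (?X \<union> ?g)) a b \<or>
        connected_component (- (?X \<union> ?g)) a d \<or> connected_component (- (?X \<union> ?g)) b d"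
        by (rule arc_crosscut_le_2[OF compact_skeleton[OF B] arc s(1,2)])
          (use s xy gX abd f0_con in auto)
      then show "connected_component (f0 - ?g) a b \<or> connected_component (f0 - ?g) a d \<or>
        connected_component (f0 - ?g) b d" using lift abd by blast
    qed
  qed
  have one: "components (f0 - ?g) = {f0 - ?g}" if "connected (f0 - ?g)"
    using that nonempty by (simp add: components_eq_sing_iff)
  have fin: "finite (components (f0 - ?g))" and c2: "card (components (f0 - ?g)) \<le> 2"
    using le2 unreach one by (cases "(x, y) \<in> reach B"; force)+
  have c1: "1 \<le> card (components (f0 - ?g))"
    using fin nonempty by (simp add: Suc_le_eq card_gt_0_iff)
  have iff: "(x, y) \<in> reach B \<longleftrightarrow> card (components (f0 - ?g)) = 2"
  proof
    assume "(x, y) \<in> reach B"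
    then have "card (components (f0 - ?g)) \<noteq> 1"
      using sep by (metis card_1_singletonE components_eq_sing_iff components_eq_sing_exists)
    then show "card (components (f0 - ?g)) = 2" using c1 c2 by linarith
  next
    assume "card (components (f0 - ?g)) = 2"
    then show "(x, y) \<in> reach B" using unreach one by force
  qed
  have iff': "(x', y') \<in> reach B \<longleftrightarrow> card (components (f0 - ?g)) = 2" if "e = {x', y'}" for x' y'
    using that xy(1) iff reach_sym by (auto simp: doubleton_eq_iff)
  have disj: "(faces B - {f0}) \<inter> components (f0 - ?g) = {}"
  proof -
    have False if "C \<in> faces B" "C \<noteq> f0" "C \<in> components (f0 - ?g)" for C
    proof -
      have "C \<inter> f0 = {}" using components_nonoverlap[OF that(1)[unfolded faces_def] f0c] that(2) by blast
      then show False using in_components_subset[OF that(3)] in_components_nonempty[OF that(3)] by blast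
    qed
    then show ?thesis by blast
  qed
  show thesis
    by (rule that[OF f0(1) _ fs disj fin c1 c2 iff']) (use f0(2) ne in blast)+
qed

section \<open>Euler's inequality\<close>

lemma finite_B: "B \<subseteq> E \<Longrightarrow> finite B"
  using finite_E finite_subset by blast

lemma faces_insert:
  assumes B: "B \<subseteq> E" and e: "{x, y} \<in> E" "{x, y} \<notin> B" and fin: "finite (faces B)"
  shows "finite (faces (insert {x, y} B)) \<and>
    card (faces (insert {x, y} B)) = card (faces B) + (if (x, y) \<in> reach B then 1 else 0)"
proof -
  from split_face[OF B e] obtain f0 where f0: "f0 \<in> faces B"
    "faces (insert {x, y} B) = (faces B - {f0}) \<union> components (f0 - path_image (c {x, y}))"
    "(faces B - {f0}) \<inter> components (f0 - path_image (c {x, y})) = {}"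
    "finite (components (f0 - path_image (c {x, y})))"
    and n: "1 \<le> card (components (f0 - path_image (c {x, y})))"
    "card (components (f0 - path_image (c {x, y}))) \<le> 2"
    "(x, y) \<in> reach B \<longleftrightarrow> card (components (f0 - path_image (c {x, y}))) = 2"
    by metis
  have "card (faces (insert {x, y} B)) = card (faces B - {f0}) + card (components (f0 - path_image (c {x, y})))"
    unfolding f0(2) using f0 fin by (intro card_Un_disjoint) auto
  moreover have "card (faces B) = Suc (card (faces B - {f0}))"
    using card_Suc_Diff1[OF fin f0(1)] by simp
  moreover have "card (components (f0 - path_image (c {x, y}))) = 1 + (if (x, y) \<in> reach B then 1 else 0)"
    using n by auto
  moreover have "finite (faces (insert {x, y} B))" unfolding f0(2) using fin f0(4) by simp
  ultimately show ?thesis by simp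
qed

lemma faces_empty: "faces {} = {UNIV}"
  unfolding faces_def skeleton_def by (simp add: components_eq_sing_iff)

text \<open>Counting components through a set \<open>R\<close> of vertices that reaches everything avoids defining
  them: an edge that closes no cycle makes one element of \<open>R\<close> redundant.\<close>

lemma euler_aux:
  assumes "B \<subseteq> E" "V \<noteq> {}"
  shows "finite (faces B) \<and> (\<exists>R. R \<subseteq> V \<and> R \<noteq> {} \<and> (\<forall>v\<in>V. \<exists>r\<in>R. (v, r) \<in> reach B) \<and>
    card B + 1 + card R \<le> card (faces B) + card V)"
  using finite_B[OF assms(1)] assms(1)
proof (induction B rule: finite_induct)
  case empty
  have "\<forall>v\<in>V. \<exists>r\<in>V. (v, r) \<in> reach {}" using reach_refl by blast
  then show ?case using assms(2) by (intro conjI exI[of _ V]) (auto simp: faces_empty)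
next
  case (insert e B)
  then have B: "B \<subseteq> E" and e: "e \<in> E" "e \<notin> B" and finB: "finite B" by auto
  from insert.IH[OF B] obtain R where fin: "finite (faces B)" and R: "R \<subseteq> V" "R \<noteq> {}"
    "\<And>v. v \<in> V \<Longrightarrow> \<exists>r\<in>R. (v, r) \<in> reach B" "card B + 1 + card R \<le> card (faces B) + card V"
    by blast
  obtain x y where xy: "e = {x, y}" "x \<noteq> y" "x \<in> V" "y \<in> V"
    using edge_cases[OF e(1)] by metis
  note fi = faces_insert[OF B e[unfolded xy(1)] fin, folded xy(1)]
  have mono: "reach B \<subseteq> reach (insert e B)" by (rule reach_mono) auto
  show ?case
  proof (cases "(x, y) \<in> reach B")
    case True
    then have "card (insert e B) + 1 + card R \<le> card (faces (insert e B)) + card V"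
      using fi R(4) e finB by simp
    moreover have "\<forall>v\<in>V. \<exists>r\<in>R. (v, r) \<in> reach (insert e B)" using R(3) mono by blast
    ultimately show ?thesis using fi R(1,2) by (intro conjI exI[of _ R]) auto
  next
    case False
    obtain r s where r: "r \<in> R" "(x, r) \<in> reach B" and s: "s \<in> R" "(y, s) \<in> reach B"
      using R(3) xy by meson
    have rs: "r \<noteq> s" using False r s reach_trans reach_sym by blast
    have finR: "finite R" using R(1) finite_V finite_subset by blast
    have "(y, x) \<in> reach (insert e B)" using xy by (intro reach_edge) auto
    then have sr: "(s, r) \<in> reach (insert e B)"
      using r s mono reach_trans reach_sym by (meson subsetD)
    have "\<exists>t\<in>R - {s}. (v, t) \<in> reach (insert e B)" if v: "v \<in> V" for v
    proof -
      obtain t where t: "t \<in> R" "(v, t) \<in> reach B" using R(3)[OF v] by blast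
      then have "(v, t) \<in> reach (insert e B)" using mono by blast
      then show ?thesis using t r rs sr reach_trans by (cases "t = s") blast+
    qed
    moreover have "card (R - {s}) + 1 = card R" using card_Suc_Diff1[OF finR s(1)] by simp
    then have "card (insert e B) + 1 + card (R - {s}) \<le> card (faces (insert e B)) + card V"
      using fi R(4) e finB False by simp
    moreover have "R - {s} \<subseteq> V" "R - {s} \<noteq> {}" using R(1) r rs by auto
    ultimately show ?thesis using fi by (intro conjI exI[of _ "R - {s}"]) auto
  qed
qed

lemma finite_faces: "B \<subseteq> E \<Longrightarrow> finite (faces B)"
proof (cases "V = {}")
  case True
  then have "E = {}" using edge_subset card_edge by fastforce
  then show "B \<subseteq> E \<Longrightarrow> finite (faces B)" by (simp add: faces_empty)
qed (use euler_aux in blast)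

text \<open>The set \<open>R\<close> of representatives has at least one element. This is the
  direction of Euler's formula that bounds the edges from above, and it holds for disconnected
  graphs as well.\<close>

lemma euler_inequality:
  assumes "V \<noteq> {}"
  shows "card E + 2 \<le> card (faces E) + card V"
proof -
  obtain R where R: "R \<subseteq> V" "R \<noteq> {}" "card E + 1 + card R \<le> card (faces E) + card V"
    using euler_aux[OF order_refl assms] by blast
  have "card R \<noteq> 0" using R finite_V finite_subset by fastforce
  then show ?thesis using R(3) by linarith
qed

section \<open>Boundaries of faces\<close>

text \<open>End points are excluded, since a face may touch at a vertex an edge that it does not
  border. Being a set, the boundary counts an edge once even if the face lies on both of its
  sides.\<close>

definition boundary :: "complex set \<Rightarrow> 'a set set" where
  "boundary f = {e \<in> E. frontier f \<inter> (path_image (c e) - p ` e) \<noteq> {}}"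

text \<open>Let \<open>e\<close> be inserted last. Its open arc lies in the open face
  \<open>f0\<close> of the remaining graph, and a face with a frontier point there must meet
  \<open>f0\<close>; so it is one of the at most two pieces of \<open>f0\<close>.\<close>

lemma card_faces_at_edge:
  assumes e: "e \<in> E"
  shows "card {f \<in> faces E. e \<in> boundary f} \<le> 2"
proof -
  let ?B = "E - {e}"
  have ins: "insert e ?B = E" using e by blast
  obtain f0 where f0: "f0 \<in> faces ?B" "path_image (c e) - p ` e \<subseteq> f0"
    "faces E = (faces ?B - {f0}) \<union> components (f0 - path_image (c e))"
    "finite (components (f0 - path_image (c e)))" "card (components (f0 - path_image (c e))) \<le> 2"
    using split_face[of ?B e] e ins by (metis Diff_iff Diff_subset insertI1)
  have "{f \<in> faces E. e \<in> boundary f} \<subseteq> components (f0 - path_image (c e))"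
  proof
    fix f assume f: "f \<in> {f \<in> faces E. e \<in> boundary f}"
    then obtain y where y: "y \<in> frontier f" "y \<in> f0" using f0(2) by (auto simp: boundary_def)
    moreover have "open f0" using open_face[OF _ f0(1)] by blast
    ultimately have "f \<inter> f0 \<noteq> {}"
      by (metis Diff_iff IntI Int_commute empty_iff frontier_def open_Int_closure_eq_empty)
    then have "\<not> (f \<in> faces ?B \<and> f \<noteq> f0)"
      using f0(1) components_nonoverlap unfolding faces_def by blast
    then show "f \<in> components (f0 - path_image (c e))" using f f0(3) by blast
  qed
  then have "card {f \<in> faces E. e \<in> boundary f} \<le> card (components (f0 - path_image (c e)))"
    using f0(4) by (rule card_mono[rotated])
  then show ?thesis using f0(5) by linarith
qed

text \<open>This allows a boundary to be studied as a small graph of its own. The face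
  \<open>g\<close> of that graph around \<open>f\<close> cannot leave \<open>f\<close>: outside the
  vertices, every frontier point of \<open>f\<close> lies on a boundary edge, and \<open>g\<close>
  avoids these.\<close>

lemma face_of_boundary:
  assumes f: "f \<in> faces E"
  shows "f \<in> faces (boundary f)"
proof -
  let ?B = "boundary f"
  have BE: "?B \<subseteq> E" by (auto simp: boundary_def)
  note fc = f[unfolded faces_def]
  have fE: "f \<inter> skeleton E = {}" using in_components_subset[OF fc] by blast
  have "f \<subseteq> - skeleton ?B" using fE skeleton_mono[OF BE] by blast
  then obtain g where g: "g \<in> faces ?B" "f \<subseteq> g"
    using exists_component_superset[of f "- skeleton ?B"] in_components_connected[OF fc]
      in_components_nonempty[OF fc] unfolding faces_def by blast
  note gc = g(1)[unfolded faces_def]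
  have gB: "g \<inter> skeleton ?B = {}" using in_components_subset[OF gc] by blast
  have op: "open g" using open_face[OF BE g(1)] .
  let ?P = "p ` V"
  have endP: "z \<in> ?P" if "z \<in> p ` e" "e \<in> E" for z e using that edge_subset by blast
  have noV: "path_image (c e) \<inter> ?P = p ` e" if "e \<in> E" for e
    using drawing that unfolding plane_drawing_def by blast
  have "closed (skeleton E)" using compact_skeleton compact_imp_closed by blast
  then have "frontier f \<subseteq> skeleton E"
    using frontier_of_components_closed_complement[OF _ fc] by blast
  have disj: "(g - ?P) \<inter> frontier f = {}"
  proof -
    have False if z: "z \<in> g" "z \<notin> ?P" "z \<in> frontier f" for z
    proof -
      obtain e where e: "e \<in> E" "z \<in> path_image (c e)"
        using z(3) \<open>frontier f \<subseteq> skeleton E\<close> by (auto simp: skeleton_def)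
      then have "z \<notin> p ` e" using endP z(2) by blast
      then have "e \<in> ?B" using e z(3) by (auto simp: boundary_def)
      then show False using e(2) z(1) gB by (auto simp: skeleton_def)
    qed
    then show ?thesis by blast
  qed
  have con: "connected (g - ?P)"
    using connected_open_delete_finite[OF op in_components_connected[OF gc]] finite_V by simp
  have "f - ?P \<noteq> {}"
  proof
    assume "f - ?P = {}"
    then have "finite f" using finite_V finite_subset[of f ?P] by blast
    then show False using open_face[OF order_refl f] in_components_nonempty[OF fc] finite_imp_not_open by blast
  qed
  then have "(g - ?P) \<inter> f \<noteq> {}" using g(2) by blast
  then have gf: "g - ?P \<subseteq> f" using connected_Int_frontier[OF con, of f] disj by blast
  \<comment> \<open>Only vertices in \<open>g\<close> remain. Such a vertex outside \<open>f\<close>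
    would be a frontier point of \<open>f\<close>, hence on some edge; near it the open arc of this
    edge enters \<open>g - ?P\<close>, which is part of \<open>f\<close>, although \<open>f\<close>
    avoids all arcs.\<close>
  have "g \<subseteq> f"
  proof (rule ccontr)
    assume "\<not> g \<subseteq> f"
    then obtain y where y: "y \<in> g" "y \<notin> f" "y \<in> ?P" using gf by blast
    have "g \<subseteq> closure f"
    proof -
      \<comment> \<open>This set is open and finite, hence empty.\<close>
      have "g - closure (g - ?P) \<subseteq> ?P" using closure_subset[of "g - ?P"] by blast
      then have "finite (g - closure (g - ?P))" using finite_V finite_subset by blast
      moreover have "open (g - closure (g - ?P))" using op by blast
      ultimately have "g \<subseteq> closure (g - ?P)" using finite_imp_not_open by blast
      then show ?thesis using closure_mono[OF gf] by blast
    qed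
    then have "y \<in> frontier f" using y open_face[OF order_refl f] by (auto simp: frontier_def interior_open)
    then obtain e where e: "e \<in> E" "y \<in> path_image (c e)"
      using \<open>frontier f \<subseteq> skeleton E\<close> by (auto simp: skeleton_def)
    have "{pathstart (c e), pathfinish (c e)} = p ` e" using ends_edge e by blast
    then have "y \<in> closure (path_image (c e) - p ` e)"
      using closure_arc_endless[OF arc_edge[OF e(1)]] e(2) by auto
    then obtain w where w: "w \<in> g" "w \<in> path_image (c e)" "w \<notin> p ` e"
      using op y(1) open_Int_closure_eq_empty[OF op, of "path_image (c e) - p ` e"] by blast
    then have "w \<in> f" using gf noV[OF e(1)] by blast
    then show False using fE e(1) w(2) by (auto simp: skeleton_def)
  qed
  then show ?thesis using g by (metis subset_antisym)
qed

section \<open>Faces of graphs with at most three edges\<close>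

text \<open>The end \<open>y\<close> lies on no edge of \<open>B\<close>, so it is unreachable from
  the other end and the new edge closes no cycle.\<close>

lemma faces_insert_pendant:
  assumes "B \<subseteq> E" "e \<in> E" "e \<notin> B" "y \<in> e" "y \<notin> \<Union>B"
  shows "card (faces (insert e B)) = card (faces B)"
proof -
  obtain x where x: "e = {x, y}" "x \<noteq> y"
    using edge_cases[OF assms(2)] assms(4) by (metis insert_commute insertE singletonD)
  have "(x, y) \<notin> reach B" using reach_in_Union x(2) assms(5) by blast
  then show ?thesis using faces_insert[of B x y] assms x finite_faces by simp
qed

lemma edge_not_subset: "e \<in> E \<Longrightarrow> f \<in> E \<Longrightarrow> e \<noteq> f \<Longrightarrow> \<not> e \<subseteq> f"
  using card_edge by (metis card.infinite card_subset_eq zero_neq_numeral)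

text \<open>Neither of two different edges contains the other, so each is pendant when it is
  added.\<close>

lemma card_faces_2:
  assumes "B \<subseteq> E" "card B \<le> 2"
  shows "card (faces B) = 1"
proof -
  have B0: "card (faces {}) = 1" by (simp add: faces_empty)
  have B1: "card (faces {e}) = 1" if e: "e \<in> E" for e
  proof -
    obtain y where "y \<in> e" using edge_cases[OF e] by blast
    then show ?thesis using faces_insert_pendant[of "{}" e y] e B0 by simp
  qed
  have B2: "card (faces {e, f}) = 1" if ef: "e \<in> E" "f \<in> E" "e \<noteq> f" for e f
  proof -
    obtain y where "y \<in> e" "y \<notin> f" using edge_not_subset[OF ef] by blast
    then show ?thesis using faces_insert_pendant[of "{f}" e y] ef B1 by simp
  qed
  have "card B = 0 \<or> card B = 1 \<or> card B = 2" using assms(2) by linarith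
  then show ?thesis
  proof (elim disjE)
    assume "card B = 0" then have "B = {}" using finite_B[OF assms(1)] by simp
    then show ?thesis using B0 by simp
  next
    assume "card B = 1" then show ?thesis using B1 assms(1) by (auto simp: card_1_singleton_iff)
  next
    assume "card B = 2" then show ?thesis using B2 assms(1) by (auto simp: card_2_iff)
  qed
qed

text \<open>If some edge has an end outside the other two, it is pendant and there is one face.
  Otherwise each edge is covered by the other two, which forces a triangle. The equation for
  \<open>B\<close> recovers the edges from the vertex set, as the later injectivity argument
  requires.\<close>

lemma card_faces_3:
  assumes B: "B \<subseteq> E" "card B = 3"
  shows "card (faces B) \<le> 2"
    and "card (faces B) = 1 \<or> \<Union>B \<in> triangles V E \<and> B = {e. e \<subseteq> \<Union>B \<and> card e = 2}"
proof -
  obtain e f g where efg: "B = {e, f, g}" "e \<noteq> f" "e \<noteq> g" "f \<noteq> g"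
    using B(2) by (auto simp: card_3_iff)
  have E: "e \<in> E" "f \<in> E" "g \<in> E" using efg B by auto
  have two: "card (faces {e, f}) = 1" "card (faces {f, g}) = 1" "card (faces {e, g}) = 1"
    using card_faces_2 E efg by simp_all
  obtain a b where ab: "e = {a, b}" "a \<noteq> b" "a \<in> V" "b \<in> V" using edge_cases[OF E(1)] by metis
  show "card (faces B) \<le> 2"
    using faces_insert[of "{f, g}" a b] efg E ab two finite_faces[of "{f, g}"] by auto
  show "card (faces B) = 1 \<or> \<Union>B \<in> triangles V E \<and> B = {e. e \<subseteq> \<Union>B \<and> card e = 2}"
  proof (cases "card (faces B) = 1")
    case False
    have "e \<subseteq> f \<union> g"
    proof (rule ccontr)
      assume "\<not> e \<subseteq> f \<union> g"
      then obtain y where "y \<in> e" "y \<notin> \<Union>{f, g}" by auto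
      from faces_insert_pendant[OF _ _ _ this] show False using efg E two False by auto
    qed
    moreover have "f \<subseteq> e \<union> g"
    proof (rule ccontr)
      assume "\<not> f \<subseteq> e \<union> g"
      then obtain y where "y \<in> f" "y \<notin> \<Union>{e, g}" by auto
      from faces_insert_pendant[OF _ _ _ this] show False using efg E two False by (auto simp: insert_commute)
    qed
    moreover have "g \<subseteq> e \<union> f"
    proof (rule ccontr)
      assume "\<not> g \<subseteq> e \<union> f"
      then obtain y where "y \<in> g" "y \<notin> \<Union>{e, f}" by auto
      from faces_insert_pendant[OF _ _ _ this] show False using efg E two False by (auto simp: insert_commute)
    qed
    ultimately have sub: "e \<subseteq> f \<union> g" "f \<subseteq> e \<union> g" "g \<subseteq> e \<union> f" by blast+
    have two_el: "\<exists>d. h = {u, d} \<and> d \<noteq> u \<and> d \<in> V" if "h \<in> E" "u \<in> h" for h u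
      using edge_cases[OF that(1)] that(2) by (metis insertE insert_commute singletonD)
    have "\<exists>u v. e = {u, v} \<and> u \<noteq> v \<and> u \<in> f"
    proof (cases "a \<in> f")
      case False
      have "b \<in> f" using False sub(1) ab(1) edge_not_subset[OF E(1,3) efg(3)] by blast
      then show ?thesis using ab insert_commute by metis
    qed (use ab in blast)
    then obtain u v where uv: "e = {u, v}" "u \<noteq> v" "u \<in> f" by blast
    obtain d where d: "f = {u, d}" "d \<noteq> u" "d \<in> V" using two_el[OF E(2) uv(3)] by blast
    have dv: "d \<noteq> v" using d(1) uv(1) efg(2) by blast
    have "v \<in> g" using sub(1) uv d(1) dv by blast
    then obtain d' where d': "g = {v, d'}" using two_el[OF E(3)] by blast
    have "d \<in> g" using sub(2) d uv dv by blast
    then have "g = {v, d}" using d' dv by blast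
    then have "B = {{u, v}, {u, d}, {v, d}}" using efg(1) uv(1) d(1) by simp
    moreover have "u = a \<and> v = b \<or> u = b \<and> v = a" using uv(1) ab(1) by (auto simp: doubleton_eq_iff)
    ultimately have "d \<noteq> a \<and> d \<noteq> b \<and> d \<in> V \<and> B = {{a, b}, {a, d}, {b, d}}"
      using d dv by (auto simp: insert_commute)
    then obtain d where d: "d \<noteq> a" "d \<noteq> b" "d \<in> V" "B = {{a, b}, {a, d}, {b, d}}" by blast
    have U: "\<Union>B = {a, b, d}" using d by auto
    have "{a, b} \<in> E" "{a, d} \<in> E" "{b, d} \<in> E" using B d by auto
    then have "\<Union>B \<in> triangles V E"
      unfolding triangles_def U using d ab by (auto simp: insert_commute)
    moreover have "B = {e. e \<subseteq> \<Union>B \<and> card e = 2}"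
      unfolding U unfolding d(4) using d(1,2) ab(2)
      by (auto simp: card_2_iff insert_commute doubleton_eq_iff)
    ultimately show ?thesis by blast
  qed simp
qed

section \<open>Edge bounds from double counting of face boundaries\<close>

lemma sum_boundary: "(\<Sum>f\<in>faces E. card (boundary f)) \<le> 2 * card E"
proof -
  have "(\<Sum>f\<in>faces E. card (boundary f)) = (\<Sum>f\<in>faces E. card {e \<in> E. e \<in> boundary f})"
    by (intro sum.cong refl arg_cong[where f = card]) (auto simp: boundary_def)
  also have "\<dots> = (\<Sum>e\<in>E. card {f \<in> faces E. e \<in> boundary f})"
    by (rule sum_multicount_gen) (use finite_faces finite_E in auto)
  also have "\<dots> \<le> (\<Sum>e\<in>E. 2)" by (intro sum_mono card_faces_at_edge)
  finally show ?thesis by simp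
qed

text \<open>If the boundary edges had a single face, this would be \<open>f\<close>, the full
  complement of their skeleton. Then \<open>f\<close> would also be the complement of the whole
  skeleton, and hence the only face.\<close>

lemma boundary_cycle:
  assumes "card (faces E) \<noteq> 1" and f: "f \<in> faces E"
  shows "card (faces (boundary f)) \<noteq> 1"
proof
  assume "card (faces (boundary f)) = 1"
  then have "faces (boundary f) = {f}"
    using face_of_boundary[OF f] by (metis card_1_singletonE singletonD)
  then have "f = - skeleton (boundary f)"
    unfolding faces_def by (metis Union_components ccpo_Sup_singleton)
  moreover have "skeleton (boundary f) \<subseteq> skeleton E" by (intro skeleton_mono) (auto simp: boundary_def)
  ultimately have "f = - skeleton E" using in_components_subset[OF f[unfolded faces_def]] by blast
  then have "connected (- skeleton E)" "- skeleton E \<noteq> {}"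
    using f in_components_connected in_components_nonempty unfolding faces_def by metis+
  then have "faces E = {- skeleton E}" unfolding faces_def by (simp add: components_eq_sing_iff)
  then show False using assms(1) by simp
qed

lemma card_boundary:
  assumes "card (faces E) \<noteq> 1" "f \<in> faces E"
  shows "3 \<le> card (boundary f)"
proof (rule ccontr)
  assume "\<not> ?thesis"
  then have "card (faces (boundary f)) = 1" by (intro card_faces_2) (auto simp: boundary_def)
  then show False using boundary_cycle[OF assms] by blast
qed

text \<open>With several faces, each has at least three boundary edges and each edge serves at most
  two faces. With one face, Euler's inequality leaves at most \<open>card V - 1\<close> edges, which
  suffices from three vertices on.\<close>

lemma card_edges_le:
  assumes "3 \<le> card V"
  shows "card E + 6 \<le> 3 * card V"
proof -
  have "V \<noteq> {}" using assms by auto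
  note eu = euler_inequality[OF this]
  show ?thesis
  proof (cases "card (faces E) = 1")
    case False
    have "3 * card (faces E) = (\<Sum>f\<in>faces E. 3)" by simp
    also have "\<dots> \<le> (\<Sum>f\<in>faces E. card (boundary f))" by (intro sum_mono card_boundary False)
    finally show ?thesis using sum_boundary eu by linarith
  qed (use eu assms in linarith)
qed

text \<open>A triangle could bound two faces only if it were the whole graph, hence the assumption on
  \<open>card E\<close>.\<close>

lemma card_triangular_faces:
  assumes "card (faces E) \<noteq> 1" "4 \<le> card E"
  shows "card {f \<in> faces E. card (boundary f) = 3} \<le> card (triangles V E)"
proof (rule card_inj_on_le[where f = "\<lambda>f. \<Union>(boundary f)"])
  have tri: "\<Union>(boundary f) \<in> triangles V E \<and> boundary f = {e. e \<subseteq> \<Union>(boundary f) \<and> card e = 2}"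
    if "f \<in> faces E" "card (boundary f) = 3" for f
    using card_faces_3(2)[of "boundary f"] boundary_cycle[OF assms(1) that(1)] that(2)
    by (auto simp: boundary_def)
  then show "(\<lambda>f. \<Union>(boundary f)) ` {f \<in> faces E. card (boundary f) = 3} \<subseteq> triangles V E" by auto
  show "finite (triangles V E)"
    by (rule finite_triangles[OF finite_V])
  show "inj_on (\<lambda>f. \<Union>(boundary f)) {f \<in> faces E. card (boundary f) = 3}"
  proof (rule inj_onI, rule ccontr)
    fix f f' assume f: "f \<in> {f \<in> faces E. card (boundary f) = 3}"
      and f': "f' \<in> {f \<in> faces E. card (boundary f) = 3}"
      and eq: "\<Union>(boundary f) = \<Union>(boundary f')" and ne: "f \<noteq> f'"
    let ?B = "boundary f"
    have BB: "boundary f' = ?B" using tri[of f] tri[of f'] f f' eq by simp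
    have BE: "?B \<subseteq> E" by (auto simp: boundary_def)
    have "f \<in> faces ?B" "f' \<in> faces ?B"
      using face_of_boundary[of f] face_of_boundary[of f'] f f' BB by auto
    moreover have "card (faces ?B) \<le> 2" using card_faces_3(1)[OF BE] f by simp
    ultimately have "faces ?B = {f, f'}"
      using ne finite_faces[OF BE] by (intro card_seteq[symmetric]) auto
    then have un: "- skeleton ?B = f \<union> f'" unfolding faces_def by (metis Union_components Union_insert Union_empty sup_bot_right)
    \<comment> \<open>The two faces would fill the complement of the triangle. A fourth edge has an
      inner point off the triangle, hence in one of them, but faces contain no point of an
      arc.\<close>
    have "?B \<noteq> E" using f assms(2) by auto
    then obtain e where e: "e \<in> E" "e \<notin> ?B" using BE by blast
    have "path_image (c e) - p ` e \<noteq> {}"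
      using nonempty_simple_path_endless[OF arc_imp_simple_path[OF arc_edge[OF e(1)]]] ends_edge[OF e(1)] by simp
    then obtain z where z: "z \<in> path_image (c e)" "z \<notin> p ` e" by blast
    have "z \<notin> skeleton ?B" using skeleton_Int_edge[OF BE e] z by blast
    then have "z \<in> f \<or> z \<in> f'" using un by blast
    moreover have "z \<in> skeleton E" using z e by (auto simp: skeleton_def)
    moreover have "f \<subseteq> - skeleton E" "f' \<subseteq> - skeleton E"
      using f f' in_components_subset unfolding faces_def by auto
    ultimately show False by blast
  qed
qed

lemma card_edges_triangles_le:
  assumes "4 \<le> card V"
  shows "2 * card E + 8 \<le> 4 * card V + card (triangles V E)"
proof -
  have "V \<noteq> {}" using assms by auto
  note eu = euler_inequality[OF this]
  \<comment> \<open>The first two cases are numerical: one face gives at most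
    \<open>card V - 1\<close> edges, and three edges give \<open>14 \<le> 16\<close>.\<close>
  consider "card (faces E) = 1" | "card E \<le> 3" | "card (faces E) \<noteq> 1" "4 \<le> card E" by linarith
  then show ?thesis
  proof cases
    case 3
    let ?T = "{f \<in> faces E. card (boundary f) = 3}"
    have "4 * card (faces E) = (\<Sum>f\<in>faces E. 4)" by simp
    \<comment> \<open>A face with three boundary edges falls one short of four, and this deficit is
      charged to its triangle.\<close>
    also have "\<dots> \<le> (\<Sum>f\<in>faces E. card (boundary f) + (if card (boundary f) = 3 then 1 else 0))"
    proof (rule sum_mono)
      fix f assume "f \<in> faces E"
      then have "3 \<le> card (boundary f)" using card_boundary[OF 3(1)] by blast
      then show "4 \<le> card (boundary f) + (if card (boundary f) = 3 then 1 else 0)" by simp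
    qed
    also have "\<dots> = (\<Sum>f\<in>faces E. card (boundary f)) + card ?T"
      using finite_faces[OF order_refl] by (simp add: sum.distrib sum.If_cases Int_def)
    finally show ?thesis using sum_boundary eu card_triangular_faces[OF 3] by linarith
  qed (use eu assms in linarith)+
qed

end

section \<open>Edge bounds for planar and apex graphs\<close>

lemma planar_subgraph:
  assumes "planar V E" "W \<subseteq> V" "F \<subseteq> E" "\<And>e. e \<in> F \<Longrightarrow> e \<subseteq> W"
  shows "planar W F"
proof -
  obtain p c where pc: "plane_drawing V E p c" using assms(1) by (auto simp: planar_def)
  have "plane_drawing W F p c"
    unfolding plane_drawing_def
  proof (intro conjI ballI impI)
    have "inj_on p V" using pc unfolding plane_drawing_def by blast
    then show "inj_on p W" using assms(2) by (rule inj_on_subset)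
    fix e assume e: "e \<in> F"
    then have "e \<in> E" using assms(3) by blast
    then have *: "arc (c e)" "{pathstart (c e), pathfinish (c e)} = p ` e" "path_image (c e) \<inter> p ` V = p ` e"
      using pc unfolding plane_drawing_def by blast+
    then show "arc (c e)" "{pathstart (c e), pathfinish (c e)} = p ` e" by blast+
    show "path_image (c e) \<inter> p ` W = p ` e" using *(3) assms(2) assms(4)[OF e] by blast
    fix f assume "f \<in> F" "e \<noteq> f"
    then show "path_image (c e) \<inter> path_image (c f) \<subseteq> p ` (e \<inter> f)"
      using pc e assms(3) unfolding plane_drawing_def by blast
  qed
  then show ?thesis by (auto simp: planar_def)
qed

lemma planar_card_edges_le:
  assumes "simple_graph V E" "planar V E" "3 \<le> card V"
  shows "card E + 6 \<le> 3 * card V"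
proof -
  obtain p c where "plane_drawing V E p c" using assms(2) by (auto simp: planar_def)
  then interpret plane_graph V E p c using assms(1) by unfold_locales
  show ?thesis by (rule card_edges_le[OF assms(3)])
qed

lemma planar_card_edges_triangles_le:
  assumes "simple_graph V E" "planar V E" "4 \<le> card V"
  shows "2 * card E + 8 \<le> 4 * card V + card (triangles V E)"
proof -
  obtain p c where "plane_drawing V E p c" using assms(2) by (auto simp: planar_def)
  then interpret plane_graph V E p c using assms(1) by unfold_locales
  show ?thesis by (rule card_edges_triangles_le[OF assms(3)])
qed

lemma simple_graph_subset:
  "simple_graph V E \<Longrightarrow> W \<subseteq> V \<Longrightarrow> F \<subseteq> E \<Longrightarrow> (\<And>e. e \<in> F \<Longrightarrow> e \<subseteq> W) \<Longrightarrow> simple_graph W F"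
  by (auto simp: simple_graph_def finite_subset)

lemma simple_graph_edge:
  assumes "simple_graph V E" "e \<in> E"
  obtains x y where "e = {x, y}" "x \<noteq> y" "x \<in> V" "y \<in> V"
proof -
  have "card e = 2" "e \<subseteq> V" using assms by (auto simp: simple_graph_def)
  then show thesis using that by (auto simp: card_2_iff)
qed

text \<open>Pigeonhole: two of the three vertices lie in the same part.\<close>

lemma triangle_edge_split:
  assumes X: "X \<in> triangles W F" and W: "W \<subseteq> S \<union> T"
  obtains e where "e \<in> F" "e \<subseteq> X" "e \<subseteq> S \<or> e \<subseteq> T"
proof -
  obtain x y z where xyz: "X = {x, y, z}" "x \<noteq> y" "x \<noteq> z" "y \<noteq> z"
    using X by (auto simp: triangles_def card_3_iff)
  then have "{x, y} \<in> F" "{x, z} \<in> F" "{y, z} \<in> F" "x \<in> S \<union> T" "y \<in> S \<union> T" "z \<in> S \<union> T"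
    using X W by (auto simp: triangles_def)
  then show thesis using xyz that[of "{x, y}"] that[of "{x, z}"] that[of "{y, z}"] by auto
qed

lemma triangle_insert:
  assumes "v \<notin> e" "e \<in> E" "e \<subseteq> V" "v \<in> V" "card e = 2" "\<And>x. x \<in> e \<Longrightarrow> {v, x} \<in> E"
  shows "insert v e \<in> triangles V E"
proof -
  obtain x y where xy: "e = {x, y}" "x \<noteq> y" using assms(5) by (auto simp: card_2_iff)
  moreover have "{v, x} \<in> E" "{v, y} \<in> E" using assms(6) xy by auto
  ultimately show ?thesis using assms(1-4) by (auto simp: triangles_def insert_commute)
qed

lemma card_cross_edges:
  assumes "finite S" "w \<notin> S"
  shows "card {e \<in> F. \<exists>s\<in>S. e = {s, w}} = card {s \<in> S. {s, w} \<in> F}"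
proof -
  have "{e \<in> F. \<exists>s\<in>S. e = {s, w}} = (\<lambda>s. {s, w}) ` {s \<in> S. {s, w} \<in> F}" by auto
  moreover have "inj_on (\<lambda>s. {s, w}) {s \<in> S. {s, w} \<in> F}"
    using assms(2) by (auto simp: inj_on_def doubleton_eq_iff)
  ultimately show ?thesis by (simp add: card_image)
qed

section \<open>The bound for apex graphs\<close>

text \<open>The bound is multiplied by three and rearranged so that it can be proved in the natural
  numbers without subtraction.\<close>

lemma apex_bound_sparse:
  assumes G: "simple_graph V E" and v: "v \<in> V" and pl: "planar (V - {v}) {e \<in> E. v \<notin> e}"
    and n: "7 \<le> card V"
    and thin: "\<And>e. e \<in> E \<Longrightarrow> card {X \<in> triangles V E. e \<subseteq> X} \<le> 2"
  shows "3 * card E + 27 \<le> 9 * card V + card (triangles V E)"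
proof -
  define W H where "W = V - {v}" and "H = {e \<in> E. v \<notin> e}"
  define S where "S = {x \<in> W. {v, x} \<in> E}"
  define T where "T = W - S"
  define SS TT where "SS = {e \<in> H. e \<subseteq> S}" and "TT = {e \<in> H. e \<subseteq> T}"
  define ST where "ST = H - SS - TT"
  have finV: "finite V" and finE: "finite E" using simple_graph_finite[OF G] by auto
  then have fin: "finite W" "finite S" "finite T" by (auto simp: W_def S_def T_def)
  have finE: "finite E" using G finV by (intro finite_subset[of E "Pow V"]) (auto simp: simple_graph_def)
  then have finH: "finite H" "finite SS" "finite TT" "finite ST" by (auto simp: H_def SS_def TT_def ST_def)
  have HE: "H \<subseteq> E" and HW: "\<And>e. e \<in> H \<Longrightarrow> e \<subseteq> W"
    using G by (auto simp: H_def W_def simple_graph_def)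
  have simpH: "simple_graph W H" by (rule simple_graph_subset[OF G]) (use HE HW W_def in auto)
  have plH: "planar W H" using pl by (simp add: W_def H_def)
  have simpT: "simple_graph T TT" by (rule simple_graph_subset[OF simpH]) (auto simp: T_def TT_def)
  have plT: "planar T TT" by (rule planar_subgraph[OF plH]) (auto simp: T_def TT_def)
  have cV: "card V = card W + 1" using card_Suc_Diff1[OF finV v] by (simp add: W_def)
  have cW: "card W = card S + card T"
    unfolding T_def using fin by (simp add: S_def card_Diff_subset card_mono)
  have cH: "card H = card SS + card TT + card ST"
  proof -
    have disj: "SS \<inter> TT = {}"
    proof -
      have False if "e \<in> SS" "e \<in> TT" for e
      proof -
        have "e = {}" using that by (auto simp: SS_def TT_def T_def)
        moreover have "card e = 2" using that HE G by (auto simp: SS_def simple_graph_def)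
        ultimately show False by simp
      qed
      then show ?thesis by blast
    qed
    have "card (SS \<union> TT) = card SS + card TT" using disj finH by (simp add: card_Un_disjoint)
    moreover have "SS \<union> TT \<union> ST = H" "(SS \<union> TT) \<inter> ST = {}" by (auto simp: ST_def SS_def TT_def)
    then have "card H = card (SS \<union> TT) + card ST"
      using finH by (metis card_Un_disjoint finite_UnI)
    ultimately show ?thesis by simp
  qed
  have cE: "card E = card H + card S"
  proof -
    have "E = H \<union> (\<lambda>x. {v, x}) ` S"
    proof
      show "E \<subseteq> H \<union> (\<lambda>x. {v, x}) ` S"
      proof
        fix e assume e: "e \<in> E"
        obtain x y where xy: "e = {x, y}" "x \<noteq> y" "x \<in> V" "y \<in> V" using simple_graph_edge[OF G e] .
        show "e \<in> H \<union> (\<lambda>x. {v, x}) ` S"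
        proof (cases "v \<in> e")
          case True
          then consider "v = x" | "v = y" using xy by auto
          then show ?thesis
          proof cases
            case 1
            then have "y \<in> S" using xy e by (auto simp: S_def W_def)
            then show ?thesis using 1 xy by blast
          next
            case 2
            then have "x \<in> S" using xy e by (auto simp: S_def W_def insert_commute)
            then show ?thesis using 2 xy by (auto simp: insert_commute)
          qed
        qed (use e in \<open>simp add: H_def\<close>)
      qed
    qed (use HE in \<open>auto simp: S_def\<close>)
    moreover have "H \<inter> (\<lambda>x. {v, x}) ` S = {}" by (auto simp: H_def)
    moreover have "inj_on (\<lambda>x. {v, x}) S" by (auto simp: inj_on_def doubleton_eq_iff)
    ultimately show ?thesis using finH fin by (metis card_Un_disjoint card_image finite_imageI)
  qed
  have card2: "card e = 2" if "e \<in> H" for e using that HE G by (auto simp: simple_graph_def)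
  have triH: "triangles W H \<subseteq> triangles V E" using HE by (auto simp: triangles_def W_def)
  have vtri: "insert v e \<in> triangles V E" if e: "e \<in> SS" for e
    by (rule triangle_insert) (use e v card2 HE HW in \<open>auto simp: SS_def S_def W_def H_def\<close>)
  have vW: "v \<notin> X" if "X \<in> triangles W H" for X using that by (auto simp: triangles_def W_def)
  \<comment> \<open>The triangles avoiding \<open>v\<close> and those spanned by \<open>v\<close>
    and an edge inside \<open>S\<close> form disjoint families.\<close>
  have ctri: "card (triangles W H) + card SS \<le> card (triangles V E)"
  proof -
    have "triangles W H \<inter> insert v ` SS = {}" using vW by blast
    moreover have "inj_on (insert v) SS"
      by (rule inj_onI) (auto simp: SS_def H_def)
    ultimately have "card (triangles W H \<union> insert v ` SS) = card (triangles W H) + card SS"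
      using fin finH finite_triangles by (metis card_Un_disjoint card_image finite_imageI)
    moreover have "triangles W H \<union> insert v ` SS \<subseteq> triangles V E" using triH vtri by blast
    ultimately show ?thesis using card_mono finite_triangles[OF finV] by metis
  qed
  \<comment> \<open>An edge inside \<open>S\<close> already lies in a triangle with apex \<open>v\<close>, which leaves room for one only.\<close>
  define tr where "tr e = {X \<in> triangles W H. e \<subseteq> X}" for e
  have trE: "tr e \<subseteq> {X \<in> triangles V E. e \<subseteq> X}" for e using triH by (auto simp: tr_def)
  have finE_tri: "finite {X \<in> triangles V E. e \<subseteq> X}" for e using finite_triangles[OF finV] by simp
  have trSS: "card (tr e) \<le> 1" if e: "e \<in> SS" for e
  proof -
    have nin: "insert v e \<notin> tr e" using vW by (auto simp: tr_def)
    have "insert (insert v e) (tr e) \<subseteq> {X \<in> triangles V E. e \<subseteq> X}"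
      using trE[of e] vtri[OF e] by blast
    then have "card (insert (insert v e) (tr e)) \<le> card {X \<in> triangles V E. e \<subseteq> X}"
      by (rule card_mono[OF finE_tri])
    moreover have "card (insert (insert v e) (tr e)) = card (tr e) + 1"
      using nin finite_subset[OF trE finE_tri] by simp
    moreover have "e \<in> E" using e HE by (auto simp: SS_def)
    ultimately show ?thesis using thin[of e] by linarith
  qed
  have trTT: "card (tr e) \<le> 2" if e: "e \<in> TT" for e
  proof -
    have "e \<in> E" using e HE by (auto simp: TT_def)
    then show ?thesis using card_mono[OF finE_tri trE, of e] thin[of e] by linarith
  qed
  have tH: "card (triangles W H) \<le> card SS + 2 * card TT"
  proof -
    have "triangles W H \<subseteq> (\<Union>e\<in>SS. tr e) \<union> (\<Union>e\<in>TT. tr e)"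
    proof
      fix X assume X: "X \<in> triangles W H"
      obtain e where "e \<in> H" "e \<subseteq> X" "e \<subseteq> S \<or> e \<subseteq> T"
        using triangle_edge_split[OF X, of S T] by (auto simp: T_def)
      then show "X \<in> (\<Union>e\<in>SS. tr e) \<union> (\<Union>e\<in>TT. tr e)"
        using X by (auto simp: tr_def SS_def TT_def)
    qed
    moreover have "finite ((\<Union>e\<in>SS. tr e) \<union> (\<Union>e\<in>TT. tr e))"
      using finH finite_subset[OF trE finE_tri] by auto
    ultimately have "card (triangles W H) \<le> card ((\<Union>e\<in>SS. tr e) \<union> (\<Union>e\<in>TT. tr e))"
      by (metis card_mono)
    also have "\<dots> \<le> card (\<Union>e\<in>SS. tr e) + card (\<Union>e\<in>TT. tr e)" by (rule card_Un_le)
    also have "\<dots> \<le> (\<Sum>e\<in>SS. card (tr e)) + (\<Sum>e\<in>TT. card (tr e))"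
      by (intro add_mono card_UN_le finH)
    also have "\<dots> \<le> (\<Sum>e\<in>SS. 1) + (\<Sum>e\<in>TT. 2)"
      by (intro add_mono sum_mono trSS trTT)
    finally show ?thesis by simp
  qed
  have m: "6 \<le> card W" using n cV by simp
  note P1 = planar_card_edges_le[OF simpH plH]
  note P2 = planar_card_edges_triangles_le[OF simpH plH]
  have STcross: "\<exists>s\<in>S. \<exists>t\<in>T. e = {s, t}" if e: "e \<in> ST" for e
  proof -
    have eH: "e \<in> H" "\<not> e \<subseteq> S" "\<not> e \<subseteq> T" using e by (auto simp: ST_def SS_def TT_def)
    obtain x y where xy: "e = {x, y}" "x \<in> W" "y \<in> W" using simple_graph_edge[OF simpH eH(1)] by metis
    then have "x \<in> S \<and> y \<in> T \<or> y \<in> S \<and> x \<in> T" using eH by (auto simp: T_def)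
    then show ?thesis using xy by (auto simp: insert_commute)
  qed
  define N where "N w = {s \<in> S. {s, w} \<in> H}" for w
  have cN: "card {e \<in> H. \<exists>s\<in>S. e = {s, w}} = card (N w)" if "w \<in> T" for w
    unfolding N_def using fin that by (intro card_cross_edges) (auto simp: T_def)
  have NS: "N w \<subseteq> S" for w by (auto simp: N_def)
  \<comment> \<open>This is the claim after substituting \<open>cE\<close>, \<open>cV\<close>,
    \<open>cW\<close> and \<open>ctri\<close>. By \<open>P2\<close> it follows whenever
    \<open>card (triangles W H) + 12 \<le> 6 * card T + 2 * card SS\<close>; the cases establish
    this inequality or count the edges of \<open>H\<close> directly.\<close>
  have goal: "3 * card H + 18 \<le> 6 * card W + 3 * card T + card (triangles W H) + card SS"
  proof -
    consider "card T = 0" | "card T = 1" | "card T = 2" | "3 \<le> card T" by linarith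
    then show ?thesis
    proof cases
      case 1
      then have "T = {}" using fin by simp
      then have "TT = {}" "ST = {}" using STcross simpT by (auto simp: simple_graph_def)
      then have "card TT = 0" "card ST = 0" by simp_all
      \<comment> \<open>Here \<open>card H = card SS\<close>, so the goal becomes
        \<open>2 * card H + 18 \<le> 6 * card W + card (triangles W H)\<close>, which
        \<open>P2\<close> gives because \<open>2 * card W \<ge> 10\<close>.\<close>
      then show ?thesis using P1 P2 m cH tH 1 by linarith
    next
      case 2
      then obtain w where w: "T = {w}" by (auto simp: card_1_singleton_iff)
      have "TT = {}" using w card2 by (force simp: TT_def subset_singleton_iff)
      moreover have "card ST \<le> card S"
      proof -
        have "ST \<subseteq> {e \<in> H. \<exists>s\<in>S. e = {s, w}}" using STcross w by (auto simp: ST_def)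
        then have "card ST \<le> card (N w)" using card_mono finH cN[of w] w by (metis (no_types, lifting) finite_subset mem_Collect_eq singletonI subsetI)
        then show ?thesis using card_mono[OF fin(2) NS, of w] by linarith
      qed
      moreover have "card TT = 0" using calculation by simp
      \<comment> \<open>The first alternative is the reduced inequality for one vertex in
        \<open>T\<close>. In the second, \<open>S\<close> spans few edges, and
        \<open>card H \<le> card SS + card S\<close> is enough.\<close>
      ultimately show ?thesis using P2 m cH tH 2 cW
        by (cases "card (triangles W H) + 6 \<le> 2 * card SS"; linarith)
    next
      case 3
      then obtain u w where uw: "T = {u, w}" "u \<noteq> w" by (auto simp: card_2_iff)
      have TTuw: "TT \<subseteq> {{u, w}}"
      proof
        fix e assume e: "e \<in> TT"
        then have "e \<subseteq> {u, w}" "card e = 2" using uw card2 by (auto simp: TT_def)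
        then show "e \<in> {{u, w}}" using uw by (auto simp: card_2_iff)
      qed
      show ?thesis
      proof (cases "TT = {}")
        case True
        then have "card TT = 0" by simp
        then show ?thesis using P2 m tH 3 by linarith
      next
        case False
        then have TT: "TT = {{u, w}}" using TTuw by blast
        \<comment> \<open>Every common neighbour of \<open>u\<close> and \<open>w\<close> in
          \<open>S\<close> completes the edge \<open>{u, w}\<close> to a triangle.\<close>
        have "card (N u \<inter> N w) \<le> card (tr {u, w})"
        proof (rule card_inj_on_le[where f = "\<lambda>s. {s, u, w}"])
          have "u \<notin> S" "w \<notin> S" using uw by (auto simp: T_def)
          then show "inj_on (\<lambda>s. {s, u, w}) (N u \<inter> N w)" using NS by (intro inj_onI) blast
          have "{u, w} \<in> H" "u \<in> W" "w \<in> W" using TT uw by (auto simp: TT_def T_def)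
          then show "(\<lambda>s. {s, u, w}) ` (N u \<inter> N w) \<subseteq> tr {u, w}"
            using \<open>u \<notin> S\<close> \<open>w \<notin> S\<close> uw(2)
            by (auto simp: N_def tr_def triangles_def S_def insert_commute card_insert_if)
          show "finite (tr {u, w})" using finite_subset[OF trE finE_tri] .
        qed
        also have "\<dots> \<le> 2" using trTT TT by blast
        finally have c2: "card (N u \<inter> N w) \<le> 2" .
        have "card (N u) + card (N w) = card (N u \<union> N w) + card (N u \<inter> N w)"
          using fin NS by (intro card_Un_Int) (auto intro: finite_subset)
        moreover have "card (N u \<union> N w) \<le> card S" using NS fin by (intro card_mono) auto
        moreover have "card ST \<le> card (N u) + card (N w)"
        proof -
          let ?F = "\<lambda>w. {e \<in> H. \<exists>s\<in>S. e = {s, w}}"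
          have "ST \<subseteq> ?F u \<union> ?F w" using STcross uw by (fastforce simp: ST_def)
          then have "card ST \<le> card (?F u \<union> ?F w)" using finH by (intro card_mono) auto
          also have "\<dots> \<le> card (?F u) + card (?F w)" by (rule card_Un_le)
          finally show ?thesis using cN uw by simp
        qed
        moreover have "card TT = 1" using TT by simp
        \<comment> \<open>With two edges inside \<open>S\<close> the reduced inequality holds.
          Otherwise \<open>card ST \<le> card S + 2 = card W\<close>, so
          \<open>card H \<le> card W + 2\<close>, which is small enough as
          \<open>card W \<ge> 6\<close>.\<close>
        ultimately show ?thesis using c2 P2 m cH tH 3 cW
          by (cases "2 \<le> card SS"; linarith)
      qed
    next
      case 4
      \<comment> \<open>Doubled and inserted into \<open>tH\<close>, this gives the reduced
        inequality.\<close>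
      have "card TT + 6 \<le> 3 * card T" by (rule planar_card_edges_le[OF simpT plT 4])
      then show ?thesis using P2 m tH by linarith
    qed
  qed
  then show ?thesis using cE cV cW ctri by linarith
qed

text \<open>Induction on the number of edges with \<open>v\<close> fixed. Deleting an edge in at
  least three triangles lowers \<open>3 * card E\<close> by three and the number of triangles by at
  least three, so the bound carries over to the larger graph.\<close>

lemma apex_bound:
  assumes "simple_graph V E" "v \<in> V" "planar (V - {v}) {e \<in> E. v \<notin> e}" "7 \<le> card V"
  shows "3 * card E + 27 \<le> 9 * card V + card (triangles V E)"
  using assms
proof (induction "card E" arbitrary: E rule: less_induct)
  case less
  have fin: "finite V" "finite E" using simple_graph_finite[OF less.prems(1)] by auto
  show ?case
  proof (cases "\<forall>e\<in>E. card {X \<in> triangles V E. e \<subseteq> X} \<le> 2")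
    case True
    show ?thesis by (rule apex_bound_sparse[OF less.prems]) (use True in blast)
  next
    case False
    then obtain e where e: "e \<in> E" "\<not> card {X \<in> triangles V E. e \<subseteq> X} \<le> 2" by blast
    let ?E = "E - {e}"
    have cE: "card E = card ?E + 1" using card_Suc_Diff1[OF fin(2) e(1)] by simp
    have simpE: "simple_graph V ?E" using less.prems(1) by (auto simp: simple_graph_def)
    have "planar (V - {v}) {f \<in> ?E. v \<notin> f}"
      by (rule planar_subgraph[OF less.prems(3)]) (use simpE in \<open>auto simp: simple_graph_def\<close>)
    moreover have "card ?E < card E" using cE by linarith
    ultimately have IH: "3 * card ?E + 27 \<le> 9 * card V + card (triangles V ?E)"
      using less.hyps[OF _ simpE less.prems(2) _ less.prems(4)] by blast
    \<comment> \<open>A triangle of the smaller graph cannot contain both ends of the deleted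
      edge.\<close>
    have "triangles V ?E \<inter> {X \<in> triangles V E. e \<subseteq> X} = {}"
    proof -
      obtain x y where "e = {x, y}" "x \<noteq> y" using simple_graph_edge[OF less.prems(1) e(1)] .
      then show ?thesis by (auto simp: triangles_def)
    qed
    then have "card (triangles V ?E) + card {X \<in> triangles V E. e \<subseteq> X}
      = card (triangles V ?E \<union> {X \<in> triangles V E. e \<subseteq> X})"
      using finite_triangles[OF fin(1)] by (simp add: card_Un_disjoint)
    also have "\<dots> \<le> card (triangles V E)"
      using finite_triangles[OF fin(1)] by (intro card_mono) (auto simp: triangles_def)
    finally show ?thesis using IH e(2) cE by linarith
  qed
qed

theorem theorem1:
  fixes V :: "'a set" and E :: "'a set set" and n t :: nat
  assumes "simple_graph V E"
    and "apex V E"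
    and "card V = n" and "n \<ge> 7"
    and "card (triangles V E) = t"
  shows "real (card E) \<le> 3 * real n - 9 + real t / 3"
proof -
  obtain v where "v \<in> V" "planar (V - {v}) {e \<in> E. v \<notin> e}"
    using assms(2) by (auto simp: apex_def)
  then have "3 * card E + 27 \<le> 9 * n + t"
    using apex_bound[OF assms(1)] assms(3-5) by blast
  then have "real (3 * card E + 27) \<le> real (9 * n + t)" by (rule of_nat_mono)
  then show ?thesis by simp
qed

end
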